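(* Let $A$ be the product of two skew-symmetric matrices of $SL(4)=SL(4,\mathbb R)$. Then, up to scale, $A$ is conjugate in $SL(4)$ to a matrix of one and only one of the following six types: (1) $\begin{pmatrix}c&-s&0&0\\ s&c&0&0\\ 0&0&c&-s\\ 0&0&s&c\end{pmatrix}$, where $c=\cos\theta$, $s=\sin\theta\neq0$; (2) $\begin{pmatrix}c&s&0&0\\ -s&c&0&0\\ 0&0&c&-s\\ 0&0&s&c\end{pmatrix}$, where $c=\cos\theta$, $s=\sin\theta\neq0$; (3) $\begin{pmatrix}1&-\lambda&0&0\\ 0&1&0&0\\ 0&0&1&0\\ 0&0&\lambda&1\end{pmatrix}$, where $\lambda\neq0$; (4) $\begin{pmatrix}1&\lambda&0&0\\ 0&1&0&0\\ 0&0&1&0\\ 0&0&\lambda&1\end{pmatrix}$, where $\lambda\neq0$; (5) $\mathrm{diag}(\lambda^{-1},\lambda^{-1},\lambda,\lambda)$, where $\lambda>0$; (6) $\mathrm{diag}(\lambda^{-1},\lambda^{-1},-\lambda,-\lambda)$, where $\lambda>0$.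
   Context: Two matrices $M,N\in SL(4)$ are conjugate in $SL(4)$ if $M=CNC^{-1}$ for some $C\in SL(4)$. "Up to scale" means up to multiplication of $A$ by a nonzero real scalar. *)

theory Defs
  imports "HOL-Analysis.Analysis"
begin

lemma vector_4 [simp]:
  "(vector [x, y, z, w] :: 'a::zero ^ 4) $ 1 = x"
  "(vector [x, y, z, w] :: 'a::zero ^ 4) $ 2 = y"
  "(vector [x, y, z, w] :: 'a::zero ^ 4) $ 3 = z"
  "(vector [x, y, z, w] :: 'a::zero ^ 4) $ 4 = w"
  unfolding vector_def by simp_all

definition SL4 :: "(real ^ 4 ^ 4) set" where
  "SL4 = {M. det M = 1}"

definition skew_symmetric :: "real ^ 'n ^ 'n \<Rightarrow> bool" where
  "skew_symmetric M \<longleftrightarrow> transpose M = - M"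

definition conjugate_SL4 :: "real ^ 4 ^ 4 \<Rightarrow> real ^ 4 ^ 4 \<Rightarrow> bool" where
  "conjugate_SL4 M N \<longleftrightarrow>
     M \<in> SL4 \<and> N \<in> SL4 \<and> (\<exists>C\<in>SL4. M = C ** N ** matrix_inv C)"

text \<open>
  A matrix is given by the list of its rows: \<open>vector [r1, r2, r3, r4] $ i $ j\<close> is the entry in
  row \<open>i\<close> and column \<open>j\<close>.
\<close>

definition rotation_matrix :: "real \<Rightarrow> real ^ 4 ^ 4" where
  "rotation_matrix \<theta> = vector
     [vector [cos \<theta>, - sin \<theta>, 0, 0],
      vector [sin \<theta>, cos \<theta>, 0, 0],
      vector [0, 0, cos \<theta>, - sin \<theta>],
      vector [0, 0, sin \<theta>, cos \<theta>]]"

definition anti_rotation_matrix :: "real \<Rightarrow> real ^ 4 ^ 4" where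
  "anti_rotation_matrix \<theta> = vector
     [vector [cos \<theta>, sin \<theta>, 0, 0],
      vector [- sin \<theta>, cos \<theta>, 0, 0],
      vector [0, 0, cos \<theta>, - sin \<theta>],
      vector [0, 0, sin \<theta>, cos \<theta>]]"

definition shear_matrix :: "real \<Rightarrow> real \<Rightarrow> real ^ 4 ^ 4" where
  "shear_matrix a b = vector
     [vector [1, a, 0, 0],
      vector [0, 1, 0, 0],
      vector [0, 0, 1, 0],
      vector [0, 0, b, 1]]"

definition diagonal_matrix :: "real \<Rightarrow> real \<Rightarrow> real \<Rightarrow> real \<Rightarrow> real ^ 4 ^ 4" where
  "diagonal_matrix a b c d = vector
     [vector [a, 0, 0, 0],
      vector [0, b, 0, 0],
      vector [0, 0, c, 0],
      vector [0, 0, 0, d]]"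

datatype normal_type = Type1 | Type2 | Type3 | Type4 | Type5 | Type6

primrec matrices_of_type :: "normal_type \<Rightarrow> (real ^ 4 ^ 4) set" where
  "matrices_of_type Type1 = {rotation_matrix \<theta> | \<theta>. sin \<theta> \<noteq> 0}"
| "matrices_of_type Type2 = {anti_rotation_matrix \<theta> | \<theta>. sin \<theta> \<noteq> 0}"
| "matrices_of_type Type3 = {shear_matrix (- l) l | l. l \<noteq> 0}"
| "matrices_of_type Type4 = {shear_matrix l l | l. l \<noteq> 0}"
| "matrices_of_type Type5 = {diagonal_matrix (inverse l) (inverse l) l l | l. l > 0}"
| "matrices_of_type Type6 = {diagonal_matrix (inverse l) (inverse l) (- l) (- l) | l. l > 0}"

end

theory Submission
  imports Defs
begin

text \<open>
  For skew-symmetric \<open>P\<close>, \<open>Q\<close> the product \<open>A = P ** Q\<close> satisfies the square root of its characteristic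
  equation, \<open>A\<^sup>2 - t A + d = 0\<close> with \<open>t = trace A / 2\<close> and \<open>d\<close> the product of the Pfaffians, which is
  \<open>1\<close> or \<open>-1\<close>. Moreover \<open>A - x = (P - x Q\<^sup>-\<^sup>1) ** Q\<close> has the rank of a skew-symmetric matrix, so it is
  zero or of rank at least two. These two facts give a basis that puts \<open>A\<close> into normal form. A change
  of basis with negative determinant is corrected by the reflection \<open>diag(-1, 1, 1, 1)\<close>, which fixes
  types 5 and 6, and exchanges types 1 and 2 as well as 3 and 4. The types are distinguished by the
  traces of \<open>N\<close> and \<open>N\<^sup>2\<close> and by whether \<open>N\<close> is scalar, except for types 1 and 2, and 3 and 4, where every intertwining matrix has
  determinant at most \<open>0\<close>. Only the scales \<open>1\<close> and \<open>-1\<close> keep the determinant equal to \<open>1\<close>.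
\<close>

section \<open>Determinants, Pfaffians and skew-symmetric matrices in dimension four\<close>

lemma det_4:
  "det (A :: 'a::comm_ring_1^4^4) =
     A$1$1 * (A$2$2 * (A$3$3 * A$4$4 - A$3$4 * A$4$3) - A$2$3 * (A$3$2 * A$4$4 - A$3$4 * A$4$2)
       + A$2$4 * (A$3$2 * A$4$3 - A$3$3 * A$4$2))
   - A$1$2 * (A$2$1 * (A$3$3 * A$4$4 - A$3$4 * A$4$3) - A$2$3 * (A$3$1 * A$4$4 - A$3$4 * A$4$1)
       + A$2$4 * (A$3$1 * A$4$3 - A$3$3 * A$4$1))
   + A$1$3 * (A$2$1 * (A$3$2 * A$4$4 - A$3$4 * A$4$2) - A$2$2 * (A$3$1 * A$4$4 - A$3$4 * A$4$1)
       + A$2$4 * (A$3$1 * A$4$2 - A$3$2 * A$4$1))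
   - A$1$4 * (A$2$1 * (A$3$2 * A$4$3 - A$3$3 * A$4$2) - A$2$2 * (A$3$1 * A$4$3 - A$3$3 * A$4$1)
       + A$2$3 * (A$3$1 * A$4$2 - A$3$2 * A$4$1))"
proof -
  have f1234: "finite {2::4, 3, 4}" "1 \<notin> {2::4, 3, 4}" by auto
  have f234: "finite {3::4, 4}" "2 \<notin> {3::4, 4}" by auto
  have f34: "finite {4::4}" "3 \<notin> {4::4}" by auto
  show ?thesis
    unfolding det_def UNIV_4
    unfolding sum_over_permutations_insert[OF f1234]
    unfolding sum_over_permutations_insert[OF f234]
    unfolding sum_over_permutations_insert[OF f34]
    unfolding permutes_sing
    by (simp add: sign_swap_id permutation_swap_id sign_compose permutation_compose sign_id
        swap_id_eq)
       (simp only: algebra_simps)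
qed

definition pfaffian4 :: "'a::comm_ring_1 ^ 4 ^ 4 \<Rightarrow> 'a" where
  "pfaffian4 P = P$1$2 * P$3$4 - P$1$3 * P$2$4 + P$1$4 * P$2$3"

lemma skew_symmetric_nth:
  assumes "skew_symmetric P"
  shows "P$i$j = - P$j$i"
proof -
  have "transpose P $ j $ i = (- P) $ j $ i" using assms by (simp only: skew_symmetric_def)
  then show ?thesis by (simp add: transpose_def)
qed

lemma skew_symmetric_4:
  fixes P :: "real^4^4"
  assumes "skew_symmetric P"
  shows "P$1$1 = 0" "P$2$2 = 0" "P$3$3 = 0" "P$4$4 = 0"
    "P$2$1 = - P$1$2" "P$3$1 = - P$1$3" "P$4$1 = - P$1$4"
    "P$3$2 = - P$2$3" "P$4$2 = - P$2$4" "P$4$3 = - P$3$4"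
proof -
  have "P$i$i = 0" for i using skew_symmetric_nth[OF assms, of i i] by linarith
  then show "P$1$1 = 0" "P$2$2 = 0" "P$3$3 = 0" "P$4$4 = 0" by simp_all
qed (rule skew_symmetric_nth[OF assms])+

lemma det_skew_symmetric:
  assumes "skew_symmetric P"
  shows "det P = (pfaffian4 P)\<^sup>2"
  unfolding det_4 pfaffian4_def skew_symmetric_4[OF assms] by (simp add: algebra_simps power2_eq_square)

text \<open>A nonzero entry \<open>R$i$j\<close> makes columns \<open>i\<close> and \<open>j\<close>
  independent: their entries in rows \<open>i\<close> and \<open>j\<close> form a block with zero
  diagonal and nonzero off-diagonal entries. Hence the rank is at least two.\<close>

lemma skew_independent_columns:
  fixes R :: "real^'n^'n"
  assumes R: "skew_symmetric R" "R \<noteq> 0"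
  obtains u w where "\<And>a b. a *\<^sub>R (R *v u) + b *\<^sub>R (R *v w) = 0 \<Longrightarrow> a = 0 \<and> b = 0"
proof -
  obtain i j where ij: "R$i$j \<noteq> 0" using R(2) by (auto simp: vec_eq_iff)
  have z: "R$k$k = 0" for k using skew_symmetric_nth[OF R(1), of k k] by linarith
  have ji: "R$j$i \<noteq> 0" using ij skew_symmetric_nth[OF R(1), of i j] by linarith
  have "a = 0 \<and> b = 0" if "a *\<^sub>R (R *v axis i 1) + b *\<^sub>R (R *v axis j 1) = 0" for a b
  proof -
    have "a * R$k$i + b * R$k$j = 0" for k
      using that by (simp add: vec_eq_iff matrix_vector_mult_basis column_def)
    from this[of i] this[of j] show ?thesis
      using ij ji by (simp add: z)
  qed
  then show ?thesis by (rule that)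
qed

text \<open>The Hodge dual of \<open>P\<close>, viewed as a 2-form on four-space. It is to the
  Pfaffian what the adjugate is to the determinant.\<close>

definition pfaffian_adjoint :: "real^4^4 \<Rightarrow> real^4^4" where
  "pfaffian_adjoint P = vector
     [vector [0, P$3$4, - P$2$4, P$2$3],
      vector [- P$3$4, 0, P$1$4, - P$1$3],
      vector [P$2$4, - P$1$4, 0, P$1$2],
      vector [- P$2$3, P$1$3, - P$1$2, 0]]"

lemma mult_pfaffian_adjoint:
  assumes "skew_symmetric P"
  shows "P ** pfaffian_adjoint P = - (pfaffian4 P *\<^sub>R mat 1)"
  by (simp add: vec_eq_iff forall_4 matrix_matrix_mult_def sum_4 mat_def pfaffian4_def
     pfaffian_adjoint_def skew_symmetric_4[OF assms])

text \<open>This is the polarisation of the identity in \<open>mult_pfaffian_adjoint\<close>,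
  because the adjoint is linear and, on skew-symmetric matrices, an involution.\<close>

lemma skew_product_add_adjoints:
  assumes "skew_symmetric P" and "skew_symmetric Q"
  shows "P ** Q + pfaffian_adjoint Q ** pfaffian_adjoint P = (trace (P ** Q) / 2) *\<^sub>R mat 1"
  by (simp add: vec_eq_iff forall_4 matrix_matrix_mult_def sum_4 mat_def trace_def
     pfaffian_adjoint_def skew_symmetric_4[OF assms(1)] skew_symmetric_4[OF assms(2)])

text \<open>The product of the two adjoints in reverse order is a partner of \<open>P ** Q\<close>:
  their sum and their product are both scalar. So \<open>P ** Q\<close> is a root of the quadratic
  polynomial with these coefficients.\<close>

lemma skew_product_quadratic:
  assumes P: "skew_symmetric P" and Q: "skew_symmetric Q"
  shows "(P ** Q) ** (P ** Q) =
    (trace (P ** Q) / 2) *\<^sub>R (P ** Q) - (pfaffian4 P * pfaffian4 Q) *\<^sub>R mat 1"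
proof -
  let ?P = "pfaffian_adjoint P" and ?Q = "pfaffian_adjoint Q"
  have "(P ** Q) ** (?Q ** ?P) = P ** (Q ** ?Q) ** ?P" by (simp add: matrix_mul_assoc)
  also have "\<dots> = (pfaffian4 P * pfaffian4 Q) *\<^sub>R mat 1"
    by (simp add: mult_pfaffian_adjoint[OF P] mult_pfaffian_adjoint[OF Q] matrix_scalar_ac
       mult.commute flip: scalar_matrix_assoc scaleR_minus_left)
  finally have 1: "(P ** Q) ** (?Q ** ?P) = (pfaffian4 P * pfaffian4 Q) *\<^sub>R mat 1" .
  have "(P ** Q) ** (P ** Q + ?Q ** ?P) = (trace (P ** Q) / 2) *\<^sub>R (P ** Q)"
    by (simp add: skew_product_add_adjoints[OF P Q] matrix_scalar_ac flip: scalar_matrix_assoc)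
  then show ?thesis using 1 by (simp add: matrix_add_ldistrib algebra_simps)
qed

section \<open>Conjugacy in SL(4) and adapted bases\<close>

lemma det_scaleR:
  fixes A :: "real^'n^'n"
  shows "det (c *\<^sub>R A) = c ^ CARD('n) * det A"
proof -
  have "c *\<^sub>R A = (\<chi> i. c *s A $ i)" by (simp add: vec_eq_iff)
  then show ?thesis by (simp add: det_rows_mul)
qed

lemma matrix_inv_inverse:
  assumes "det (A :: real^'n^'n) \<noteq> 0"
  shows "A ** matrix_inv A = mat 1" "matrix_inv A ** A = mat 1"
proof -
  have "\<exists>B. A ** B = mat 1 \<and> B ** A = mat 1"
    using assms by (simp flip: invertible_det_nz add: invertible_def)
  then have "A ** matrix_inv A = mat 1 \<and> matrix_inv A ** A = mat 1"
    unfolding matrix_inv_def by (rule someI_ex)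
  then show "A ** matrix_inv A = mat 1" "matrix_inv A ** A = mat 1" by simp_all
qed

text \<open>Rescaling \<open>C\<close> preserves the intertwining relation and multiplies its
  determinant by the fourth power of the factor, so a positive determinant can be brought to
  one.\<close>

lemma conjugate_SL4_of_det_pos:
  assumes "det A = 1" and AC: "A ** C = C ** N" and "det C > 0"
  shows "conjugate_SL4 A N"
proof -
  have N: "det N = 1"
    using arg_cong[OF AC, of det] assms(1,3) by (simp add: det_mul)
  define r where "r = root 4 (inverse (det C))"
  define D where "D = r *\<^sub>R C"
  have "r ^ 4 = inverse (det C)" using assms by (simp add: r_def real_root_pow_pos2)
  then have D: "det D = 1" using assms by (simp add: D_def det_scaleR)
  have "A ** D = D ** N" using AC by (simp add: D_def matrix_scalar_ac flip: scalar_matrix_assoc)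
  then have "D ** N ** matrix_inv D = A ** (D ** matrix_inv D)" by (simp add: matrix_mul_assoc)
  then have "A = D ** N ** matrix_inv D" using D by (simp add: matrix_inv_inverse)
  then show ?thesis using D N assms(1) unfolding conjugate_SL4_def SL4_def by blast
qed

definition reflection :: "real^4^4" where
  "reflection = diagonal_matrix (- 1) 1 1 1"

lemma det_reflection: "det reflection = - 1"
  by (simp add: reflection_def diagonal_matrix_def det_4)

lemmas normal_form_defs = rotation_matrix_def anti_rotation_matrix_def shear_matrix_def
  diagonal_matrix_def reflection_def

lemma conjugate_SL4_of_det_nonzero:
  assumes A: "det A = 1" and AC: "A ** C = C ** N" and C: "det C \<noteq> 0"
    and N: "N ** reflection = reflection ** N'"
  shows "conjugate_SL4 A N \<or> conjugate_SL4 A N'"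
proof (cases "det C > 0")
  case True
  then show ?thesis using conjugate_SL4_of_det_pos A AC by blast
next
  case False
  have "A ** (C ** reflection) = (C ** reflection) ** N'"
    using AC N by (metis matrix_mul_assoc)
  moreover have "det (C ** reflection) > 0"
    using False C by (simp add: det_mul det_reflection)
  ultimately show ?thesis using conjugate_SL4_of_det_pos A by blast
qed

lemma reflection_commutes:
  "rotation_matrix \<theta> ** reflection = reflection ** anti_rotation_matrix \<theta>"
  "shear_matrix (- l) l ** reflection = reflection ** shear_matrix l l"
  "diagonal_matrix a b c d ** reflection = reflection ** diagonal_matrix a b c d"
  by (simp_all add: vec_eq_iff forall_4 matrix_matrix_mult_def sum_4 normal_form_defs)

text \<open>Take for \<open>C\<close> the matrix with columns \<open>v j\<close>. The action of
  \<open>A\<close> on these vectors is the intertwining relation read column by column, and their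
  independence makes \<open>C\<close> injective.\<close>

lemma basis_change:
  fixes A N :: "real^'n^'n" and v :: "'n \<Rightarrow> real^'n"
  assumes A: "\<And>j. A *v v j = (\<Sum>i\<in>UNIV. N$i$j *\<^sub>R v i)"
    and v: "\<And>x. (\<Sum>i\<in>UNIV. x i *\<^sub>R v i) = 0 \<Longrightarrow> \<forall>i. x i = 0"
  obtains C where "A ** C = C ** N" "det C \<noteq> 0"
proof
  let ?C = "\<chi> i j. v j $ i"
  have "(A ** ?C) $ i $ j = (?C ** N) $ i $ j" for i j
    using arg_cong[OF A[of j], of "\<lambda>u. u $ i"]
    by (simp add: matrix_matrix_mult_def matrix_vector_mult_def mult.commute)
  then show "A ** ?C = ?C ** N" by (simp add: vec_eq_iff)
  have "x = 0" if "?C *v x = 0" for x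
  proof -
    have "(\<Sum>i\<in>UNIV. x $ i *\<^sub>R v i) = ?C *v x"
      by (simp add: vec_eq_iff matrix_vector_mult_def mult.commute)
    then have "\<forall>i. x $ i = 0" using that by (intro v) simp
    then show ?thesis by (simp add: vec_eq_iff)
  qed
  then have "\<exists>B. B ** ?C = mat 1" unfolding matrix_left_invertible_ker by blast
  then show "det ?C \<noteq> 0"
    by (metis invertible_det_nz invertible_left_inverse)
qed

lemma basis_change_4:
  fixes A N :: "real^4^4"
  assumes "A *v v1 = N$1$1 *\<^sub>R v1 + N$2$1 *\<^sub>R v2 + N$3$1 *\<^sub>R v3 + N$4$1 *\<^sub>R v4"
    and "A *v v2 = N$1$2 *\<^sub>R v1 + N$2$2 *\<^sub>R v2 + N$3$2 *\<^sub>R v3 + N$4$2 *\<^sub>R v4"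
    and "A *v v3 = N$1$3 *\<^sub>R v1 + N$2$3 *\<^sub>R v2 + N$3$3 *\<^sub>R v3 + N$4$3 *\<^sub>R v4"
    and "A *v v4 = N$1$4 *\<^sub>R v1 + N$2$4 *\<^sub>R v2 + N$3$4 *\<^sub>R v3 + N$4$4 *\<^sub>R v4"
    and ind: "\<And>a b c d. a *\<^sub>R v1 + b *\<^sub>R v2 + c *\<^sub>R v3 + d *\<^sub>R v4 = 0 \<Longrightarrow>
      a = 0 \<and> b = 0 \<and> c = 0 \<and> d = 0"
  obtains C where "A ** C = C ** N" "det C \<noteq> 0"
proof (rule basis_change[of A "($) (vector [v1, v2, v3, v4] :: real^4^4)" N])
  let ?v = "vector [v1, v2, v3, v4] :: real^4^4"
  have "\<forall>j. A *v ?v $ j = (\<Sum>i\<in>UNIV. N$i$j *\<^sub>R ?v $ i)"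
    using assms(1-4) by (simp add: forall_4 sum_4)
  then show "A *v ?v $ j = (\<Sum>i\<in>UNIV. N$i$j *\<^sub>R ?v $ i)" for j by blast
  show "\<forall>i. x i = 0" if "(\<Sum>i\<in>UNIV. x i *\<^sub>R ?v $ i) = 0" for x
    using that ind[of "x 1" "x 2" "x 3" "x 4"] by (simp add: forall_4 sum_4)
qed (rule that)

section \<open>Normal forms from the quadratic equation\<close>

lemma matrix_vector_mult_shift:
  fixes A :: "real^'n^'n"
  shows "(A - x *\<^sub>R mat 1) *v u = A *v u - x *\<^sub>R u"
  by (simp add: matrix_vector_mult_diff_rdistrib flip: scaleR_matrix_vector_assoc)

lemma matrix_sub_rdistrib:
  fixes A B :: "'a::ring_1^'n^'m"
  shows "(A - B) ** C = A ** C - B ** C"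
  by (simp add: matrix_matrix_mult_def vec_eq_iff sum_subtractf left_diff_distrib)

lemma skew_product_shift_rank:
  fixes P Q :: "real^'n^'n"
  assumes P: "skew_symmetric P" and Q: "skew_symmetric Q" and "det Q \<noteq> 0"
    and A: "P ** Q \<noteq> x *\<^sub>R mat 1"
  obtains u w where "\<And>a b. a *\<^sub>R ((P ** Q - x *\<^sub>R mat 1) *v u) + b *\<^sub>R ((P ** Q - x *\<^sub>R mat 1) *v w) = 0
    \<Longrightarrow> a = 0 \<and> b = 0"
proof -
  let ?I = "matrix_inv Q"
  note I = matrix_inv_inverse[OF \<open>det Q \<noteq> 0\<close>]
  \<comment> \<open>The inverse of \<open>Q\<close> is again skew-symmetric, since
    \<open>- transpose ?I\<close> is a left inverse of \<open>Q\<close> too.\<close>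
  have "transpose ?I ** transpose Q = mat 1"
    using I(1) by (metis matrix_transpose_mul transpose_mat)
  then have "transpose ?I ** (- Q) = mat 1" using Q by (simp only: skew_symmetric_def)
  then have "- transpose ?I ** Q = mat 1"
    by (simp add: matrix_matrix_mult_def vec_eq_iff)
  then have "- transpose ?I = ?I" using I by (metis matrix_mul_assoc matrix_mul_lid matrix_mul_rid)
  then have "transpose ?I = - ?I" by (metis minus_minus)
  define R where "R = P - x *\<^sub>R ?I"
  have "transpose R = transpose P - x *\<^sub>R transpose ?I"
    by (simp add: R_def transpose_def vec_eq_iff)
  then have R: "skew_symmetric R"
    using P \<open>transpose ?I = - ?I\<close> by (simp add: skew_symmetric_def R_def)
  have RQ: "P ** Q - x *\<^sub>R mat 1 = R ** Q"
    using I by (simp add: R_def matrix_sub_rdistrib flip: scalar_matrix_assoc)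
  have "R \<noteq> 0" using RQ A by auto
  then obtain u w where uw: "\<And>a b. a *\<^sub>R (R *v u) + b *\<^sub>R (R *v w) = 0 \<Longrightarrow> a = 0 \<and> b = 0"
    using skew_independent_columns[OF R] by blast
  \<comment> \<open>The vectors found for \<open>R\<close> are pulled back through
    \<open>Q\<close>.\<close>
  have "(P ** Q - x *\<^sub>R mat 1) *v (?I *v z) = R *v z" for z
    using I by (simp add: RQ matrix_vector_mul_assoc flip: matrix_mul_assoc)
  then show thesis using that[of "?I *v u" "?I *v w"] uw by simp
qed

text \<open>Since \<open>A - x\<close> and \<open>A - y\<close> multiply to zero, the image of each
  consists of eigenvectors for the other root. Both images have dimension at least two, so they
  supply an eigenbasis.\<close>

lemma normal_form_real_distinct:
  fixes P Q A :: "real^4^4"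
  assumes P: "skew_symmetric P" and Q: "skew_symmetric Q" "det Q \<noteq> 0" and A: "A = P ** Q"
    and det: "det A = 1"
    and quad: "A ** A = (x + y) *\<^sub>R A - (x * y) *\<^sub>R mat 1" and tr: "trace A = 2 * (x + y)"
    and xy: "x \<noteq> y"
  shows "conjugate_SL4 A (diagonal_matrix x x y y)"
proof -
  \<comment> \<open>If \<open>A\<close> were the scalar \<open>x\<close>, its trace would be
    \<open>4 * x\<close>, forcing \<open>x = y\<close>; likewise for \<open>y\<close>.\<close>
  have ne: "A \<noteq> x *\<^sub>R mat 1" "A \<noteq> y *\<^sub>R mat 1"
    using tr xy by (auto simp: trace_def mat_def)
  have quadv: "A *v (A *v u) = (x + y) *\<^sub>R (A *v u) - (x * y) *\<^sub>R u" for u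
    by (simp add: matrix_vector_mul_assoc quad matrix_vector_mult_diff_rdistrib
        flip: scaleR_matrix_vector_assoc)
  have eig: "A *v ((A - y *\<^sub>R mat 1) *v u) = x *\<^sub>R ((A - y *\<^sub>R mat 1) *v u)"
    "A *v ((A - x *\<^sub>R mat 1) *v u) = y *\<^sub>R ((A - x *\<^sub>R mat 1) *v u)" for u
    by (simp_all only: matrix_vector_mult_shift matrix_vector_mult_diff_distrib
        matrix_vector_mult_scaleR quadv) (simp_all add: algebra_simps)
  obtain u1 u2 where u: "\<And>a b. a *\<^sub>R ((A - y *\<^sub>R mat 1) *v u1) + b *\<^sub>R ((A - y *\<^sub>R mat 1) *v u2) = 0
    \<Longrightarrow> a = 0 \<and> b = 0"
    using skew_product_shift_rank[OF P Q] ne(2) unfolding A by blast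
  obtain u3 u4 where w: "\<And>a b. a *\<^sub>R ((A - x *\<^sub>R mat 1) *v u3) + b *\<^sub>R ((A - x *\<^sub>R mat 1) *v u4) = 0
    \<Longrightarrow> a = 0 \<and> b = 0"
    using skew_product_shift_rank[OF P Q] ne(1) unfolding A by blast
  define v1 v2 v3 v4 where v: "v1 = (A - y *\<^sub>R mat 1) *v u1" "v2 = (A - y *\<^sub>R mat 1) *v u2"
    "v3 = (A - x *\<^sub>R mat 1) *v u3" "v4 = (A - x *\<^sub>R mat 1) *v u4"
  have Av: "A *v v1 = x *\<^sub>R v1" "A *v v2 = x *\<^sub>R v2" "A *v v3 = y *\<^sub>R v3" "A *v v4 = y *\<^sub>R v4"
    by (simp_all add: v eig)
  have ind: "a = 0 \<and> b = 0 \<and> c = 0 \<and> d = 0"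
    if z: "a *\<^sub>R v1 + b *\<^sub>R v2 + c *\<^sub>R v3 + d *\<^sub>R v4 = 0" for a b c d
  proof -
    define p q where pq: "p = a *\<^sub>R v1 + b *\<^sub>R v2" "q = c *\<^sub>R v3 + d *\<^sub>R v4"
    have Apq: "A *v p = x *\<^sub>R p" "A *v q = y *\<^sub>R q"
      by (simp_all add: pq matrix_vector_right_distrib matrix_vector_mult_scaleR Av scaleR_add_right mult.commute)
    have "q + p = 0" using z by (simp add: pq add_ac)
    then have "q = - p" by (simp add: eq_neg_iff_add_eq_0)
    have "A *v (- p) = - (x *\<^sub>R p)"
      using Apq(1) matrix_vector_mult_diff_distrib[of A 0 p] by simp
    then have "(x - y) *\<^sub>R p = 0" using Apq(2) \<open>q = - p\<close> by (simp add: algebra_simps)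
    then have "p = 0" "q = 0" using xy \<open>q = - p\<close> by simp_all
    then show ?thesis using u[of a b] w[of c d] by (simp add: pq v)
  qed
  obtain C where "A ** C = C ** diagonal_matrix x x y y" "det C \<noteq> 0"
    by (rule basis_change_4[of A v1 "diagonal_matrix x x y y" v2 v3 v4])
       (use ind in \<open>simp_all add: Av diagonal_matrix_def\<close>)
  \<comment> \<open>The diagonal form commutes with the reflection, so both alternatives are the
    same.\<close>
  then show ?thesis using conjugate_SL4_of_det_nonzero[OF det _ _ reflection_commutes(3)] by blast
qed

text \<open>Here \<open>A - 1\<close> has square zero and rank at least two. Two vectors with
  independent images, together with these images, form a basis in which \<open>A\<close> is a double
  shear.\<close>

lemma normal_form_unipotent:
  fixes P Q A :: "real^4^4"
  assumes P: "skew_symmetric P" and Q: "skew_symmetric Q" "det Q \<noteq> 0" and A: "A = P ** Q"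
    and det: "det A = 1"
    and quad: "A ** A = 2 *\<^sub>R A - mat 1" and ne: "A \<noteq> mat 1"
  shows "conjugate_SL4 A (shear_matrix (- 1) 1) \<or> conjugate_SL4 A (shear_matrix 1 1)"
proof -
  have quadv: "A *v (A *v u) = 2 *\<^sub>R (A *v u) - u" for u
    by (simp add: matrix_vector_mul_assoc quad matrix_vector_mult_diff_rdistrib
        flip: scaleR_matrix_vector_assoc)
  obtain u w where uw: "\<And>a b. a *\<^sub>R ((A - 1 *\<^sub>R mat 1) *v u) + b *\<^sub>R ((A - 1 *\<^sub>R mat 1) *v w) = 0
    \<Longrightarrow> a = 0 \<and> b = 0"
    using skew_product_shift_rank[OF P Q, of 1] ne unfolding A by auto
  \<comment> \<open>The opposite signs of the two images produce the entries \<open>-1\<close> and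
    \<open>1\<close> of the shear.\<close>
  define v1 v4 where v: "v1 = u - A *v u" "v4 = A *v w - w"
  have Au: "A *v u = u - v1" and Aw: "A *v w = w + v4" by (simp_all add: v)
  have Av: "A *v v1 = v1" "A *v v4 = v4"
    by (simp_all add: v quadv matrix_vector_mult_diff_distrib) (simp_all add: scaleR_2)
  have ind2: "a = 0 \<and> b = 0" if "a *\<^sub>R v1 + b *\<^sub>R v4 = 0" for a b
    using uw[of "- a" b] that by (simp add: matrix_vector_mult_shift[of A 1, simplified] v scaleR_diff_right)
  have ind: "a = 0 \<and> b = 0 \<and> c = 0 \<and> d = 0"
    if z: "a *\<^sub>R v1 + b *\<^sub>R u + c *\<^sub>R w + d *\<^sub>R v4 = 0" for a b c d
  proof -
    \<comment> \<open>Applying \<open>A\<close> reproduces the relation up to a combination of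
      \<open>v1\<close> and \<open>v4\<close>, which must therefore vanish.\<close>
    have "A *v (a *\<^sub>R v1 + b *\<^sub>R u + c *\<^sub>R w + d *\<^sub>R v4) = 0" by (simp add: z)
    then have "(a *\<^sub>R v1 + b *\<^sub>R u + c *\<^sub>R w + d *\<^sub>R v4) + ((- b) *\<^sub>R v1 + c *\<^sub>R v4) = 0"
      by (simp add: matrix_vector_right_distrib matrix_vector_mult_scaleR Av Au Aw algebra_simps)
    then have "b = 0 \<and> c = 0" using ind2[of "- b" c] z by simp
    then show ?thesis using ind2[of a d] z by simp
  qed
  obtain C where "A ** C = C ** shear_matrix (- 1) 1" "det C \<noteq> 0"
    by (rule basis_change_4[of A v1 "shear_matrix (- 1) 1" u w v4])
       (use ind in \<open>simp_all add: Av Au Aw shear_matrix_def\<close>)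
  then show ?thesis
    using conjugate_SL4_of_det_nonzero[OF det _ _ reflection_commutes(2)] by blast
qed

text \<open>The matrix \<open>J\<close> turns four-space into a complex plane, with
  \<open>a *\<^sub>R u + b *\<^sub>R (J *v u)\<close> being \<open>a + i b\<close> times
  \<open>u\<close>. Any \<open>w\<close> outside the complex line of \<open>u\<close> completes a
  complex basis.\<close>

lemma complex_structure_basis:
  fixes J :: "real^4^4"
  assumes J: "\<And>u. J *v (J *v u) = - u"
  obtains u w where "\<And>a b c d. a *\<^sub>R u + b *\<^sub>R (J *v u) + c *\<^sub>R w + d *\<^sub>R (J *v w) = 0
    \<Longrightarrow> a = 0 \<and> b = 0 \<and> c = 0 \<and> d = 0"
proof -
  \<comment> \<open>Multiplication by the conjugate \<open>a - i b\<close>.\<close>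
  have inv: "(a\<^sup>2 + b\<^sup>2) *\<^sub>R z = a *\<^sub>R y - b *\<^sub>R (J *v y)"
    if "y = a *\<^sub>R z + b *\<^sub>R (J *v z)" for a b y z
    by (simp add: that matrix_vector_right_distrib matrix_vector_mult_scaleR J algebra_simps power2_eq_square)
  define u :: "real^4" where "u = axis 1 1"
  have "u \<noteq> 0" by (simp add: u_def axis_eq_0_iff)
  have "dim (span {u, J *v u}) \<le> card {u, J *v u}" by (simp add: dim_le_card')
  also have "\<dots> < DIM(real^4)" by (simp add: card_insert_if)
  finally have "span {u, J *v u} \<noteq> UNIV" by (metis dim_UNIV less_irrefl)
  then obtain w where w: "w \<notin> span {u, J *v u}" by blast
  have "a = 0 \<and> b = 0 \<and> c = 0 \<and> d = 0"
    if z: "a *\<^sub>R u + b *\<^sub>R (J *v u) + c *\<^sub>R w + d *\<^sub>R (J *v w) = 0" for a b c d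
  proof -
    have "c *\<^sub>R w + d *\<^sub>R (J *v w) + (a *\<^sub>R u + b *\<^sub>R (J *v u)) = 0"
      using z by (simp add: add_ac)
    then have "(- a) *\<^sub>R u + (- b) *\<^sub>R (J *v u) = c *\<^sub>R w + d *\<^sub>R (J *v w)"
      by (simp add: eq_neg_iff_add_eq_0[symmetric])
    note inv[OF this]
    also have "c *\<^sub>R ((- a) *\<^sub>R u + (- b) *\<^sub>R (J *v u)) - d *\<^sub>R (J *v ((- a) *\<^sub>R u + (- b) *\<^sub>R (J *v u)))
      \<in> span {u, J *v u}"
      by (simp add: matrix_vector_mult_diff_distrib matrix_vector_right_distrib matrix_vector_mult_scaleR J
          span_add span_diff span_scale span_base span_neg del: scaleR_minus_left)
    finally have sp: "(c\<^sup>2 + d\<^sup>2) *\<^sub>R w \<in> span {u, J *v u}" .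
    \<comment> \<open>Otherwise division would put \<open>w\<close> into the complex line of
      \<open>u\<close>.\<close>
    have "c\<^sup>2 + d\<^sup>2 = 0"
    proof (rule ccontr)
      assume "c\<^sup>2 + d\<^sup>2 \<noteq> 0"
      then have "w = inverse (c\<^sup>2 + d\<^sup>2) *\<^sub>R ((c\<^sup>2 + d\<^sup>2) *\<^sub>R w)" by simp
      then show False using w span_scale[OF sp] by metis
    qed
    then have cd: "c = 0" "d = 0" by (simp_all add: sum_power2_eq_zero_iff)
    then have "(a\<^sup>2 + b\<^sup>2) *\<^sub>R u = 0" using inv[of 0 a u b] z by simp
    then show ?thesis using cd \<open>u \<noteq> 0\<close> by (simp add: sum_power2_eq_zero_iff)
  qed
  then show thesis by (rule that)
qed

text \<open>With \<open>t = 2 * cos \<theta>\<close> the equation says that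
  \<open>A - cos \<theta>\<close> has square \<open>- (sin \<theta>)\<^sup>2\<close>. Dividing by
  \<open>sin \<theta>\<close> gives a complex structure \<open>J\<close>, and \<open>A\<close> acts
  as multiplication by \<open>cos \<theta> + i sin \<theta>\<close>.\<close>

lemma normal_form_elliptic:
  fixes A :: "real^4^4"
  assumes det: "det A = 1" and quad: "A ** A = t *\<^sub>R A - mat 1" and t: "\<bar>t\<bar> < 2"
  obtains \<theta> where "sin \<theta> \<noteq> 0"
    "conjugate_SL4 A (rotation_matrix \<theta>) \<or> conjugate_SL4 A (anti_rotation_matrix \<theta>)"
proof -
  define \<theta> where "\<theta> = arccos (t / 2)"
  have c: "t = 2 * cos \<theta>" using t by (simp add: \<theta>_def cos_arccos_abs)
  have s: "sin \<theta> \<noteq> 0"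
  proof
    assume "sin \<theta> = 0"
    then have "\<bar>cos \<theta>\<bar> = 1" by (rule sin_zero_abs_cos_one)
    then show False using t c by simp
  qed
  define J where "J = inverse (sin \<theta>) *\<^sub>R (A - cos \<theta> *\<^sub>R mat 1)"
  have Jv: "J *v u = inverse (sin \<theta>) *\<^sub>R (A *v u - cos \<theta> *\<^sub>R u)" for u
    by (simp add: J_def matrix_vector_mult_shift flip: scaleR_matrix_vector_assoc)
  have Av: "A *v u = cos \<theta> *\<^sub>R u + sin \<theta> *\<^sub>R (J *v u)" for u using s by (simp add: Jv)
  have quadv: "A *v (A *v u) = (2 * cos \<theta>) *\<^sub>R (A *v u) - u" for u
    by (simp add: matrix_vector_mul_assoc quad c matrix_vector_mult_diff_rdistrib
        flip: scaleR_matrix_vector_assoc)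
  have J: "J *v (J *v u) = - u" for u
  proof -
    have "J *v (J *v u) = (inverse (sin \<theta>))\<^sup>2 *\<^sub>R
        (A *v (A *v u) - (2 * cos \<theta>) *\<^sub>R (A *v u) + (cos \<theta>)\<^sup>2 *\<^sub>R u)"
      by (simp only: Jv matrix_vector_mult_diff_distrib matrix_vector_mult_scaleR)
         (simp add: vec_eq_iff algebra_simps power2_eq_square)
    also have "\<dots> = - (((inverse (sin \<theta>))\<^sup>2 * (1 - (cos \<theta>)\<^sup>2)) *\<^sub>R u)"
      by (simp add: quadv algebra_simps)
    also have "\<dots> = - u" using s by (simp flip: sin_squared_eq add: power_inverse)
    finally show ?thesis .
  qed
  obtain u w where ind: "\<And>a b c d. a *\<^sub>R u + b *\<^sub>R (J *v u) + c *\<^sub>R w + d *\<^sub>R (J *v w) = 0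
    \<Longrightarrow> a = 0 \<and> b = 0 \<and> c = 0 \<and> d = 0"
    using complex_structure_basis[OF J] by blast
  obtain C where "A ** C = C ** rotation_matrix \<theta>" "det C \<noteq> 0"
    by (rule basis_change_4[of A u "rotation_matrix \<theta>" "J *v u" w "J *v w"])
       (use ind in \<open>simp_all add: Av J rotation_matrix_def\<close>)
  then have "conjugate_SL4 A (rotation_matrix \<theta>) \<or> conjugate_SL4 A (anti_rotation_matrix \<theta>)"
    using conjugate_SL4_of_det_nonzero[OF det _ _ reflection_commutes(1)] by blast
  with s show thesis by (rule that)
qed

section \<open>Invariants separating the six types\<close>

text \<open>The relation between two normal forms of multiples of the same matrix; \<open>e\<close>
  is the quotient of the two scales. The intertwining equation avoids inverses.\<close>

definition sign_similar :: "real^4^4 \<Rightarrow> real^4^4 \<Rightarrow> bool" where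
  "sign_similar M N \<longleftrightarrow> (\<exists>e C. e\<^sup>2 = 1 \<and> det C = 1 \<and> M ** C = e *\<^sub>R (C ** N))"

lemma trace_scaleR: "trace (c *\<^sub>R A) = c * trace (A :: real^'n^'n)"
  by (simp add: trace_def sum_distrib_left)

lemma trace_intertwined:
  fixes M N C :: "real^'n^'n"
  assumes C: "det C \<noteq> 0" and MC: "M ** C = e *\<^sub>R (C ** N)"
  shows "trace M = e * trace N"
proof -
  have "trace M = trace (M ** C ** matrix_inv C)"
    using matrix_inv_inverse[OF C] by (simp flip: matrix_mul_assoc)
  also have "\<dots> = e * trace (C ** N ** matrix_inv C)"
    by (simp add: MC trace_scaleR flip: scalar_matrix_assoc)
  also have "\<dots> = e * trace N"
    using matrix_inv_inverse[OF C] by (subst trace_mul_sym) (simp add: matrix_mul_assoc)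
  finally show ?thesis .
qed

text \<open>The trace changes by the factor \<open>e\<close>, and \<open>M ** M\<close> is
  intertwined with \<open>N ** N\<close> with factor \<open>e\<^sup>2\<close>, so the sign drops out
  of both quantities.\<close>

lemma sign_similar_trace:
  assumes "sign_similar M N"
  shows "(trace M)\<^sup>2 = (trace N)\<^sup>2" "trace (M ** M) = trace (N ** N)"
proof -
  obtain e C where e: "e\<^sup>2 = 1" and C: "det C = 1" and MC: "M ** C = e *\<^sub>R (C ** N)"
    using assms by (auto simp: sign_similar_def)
  show "(trace M)\<^sup>2 = (trace N)\<^sup>2"
    using trace_intertwined[OF _ MC] C e by (simp add: power_mult_distrib)
  have "M ** M ** C = M ** (M ** C)" by (simp add: matrix_mul_assoc)
  also have "\<dots> = e *\<^sub>R ((M ** C) ** N)"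
    by (simp add: MC matrix_scalar_ac matrix_mul_assoc flip: scalar_matrix_assoc)
  also have "\<dots> = (e * e) *\<^sub>R (C ** (N ** N))"
    by (simp add: MC matrix_mul_assoc flip: scalar_matrix_assoc)
  also have "\<dots> = 1 *\<^sub>R (C ** (N ** N))" using e by (simp add: power2_eq_square)
  finally show "trace (M ** M) = trace (N ** N)"
    using trace_intertwined[of C "M ** M" 1 "N ** N"] C by simp
qed

text \<open>Comparing determinants gives \<open>k ^ 4 = m ^ 4\<close>. So the real quotient
  \<open>e = k / m\<close> has fourth power one, and its square, being nonnegative, is one.\<close>

lemma conjugate_SL4_sign_similar:
  assumes "conjugate_SL4 (k *\<^sub>R A) M" and "conjugate_SL4 (m *\<^sub>R A) N"
  shows "sign_similar M N"
proof -
  obtain C where C: "det C = 1" "k *\<^sub>R A = C ** M ** matrix_inv C" and k: "det (k *\<^sub>R A) = 1"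
    using assms(1) by (auto simp: conjugate_SL4_def SL4_def)
  obtain D where D: "det D = 1" "m *\<^sub>R A = D ** N ** matrix_inv D" and m: "det (m *\<^sub>R A) = 1"
    using assms(2) by (auto simp: conjugate_SL4_def SL4_def)
  note I = matrix_inv_inverse[of C] matrix_inv_inverse[of D]
  have km: "k ^ 4 * det A = 1" "m ^ 4 * det A = 1" using k m by (simp_all add: det_scaleR)
  then have "m \<noteq> 0" "det A \<noteq> 0" by auto
  with km have "k ^ 4 = m ^ 4" by (metis mult_right_cancel)
  define e where "e = k / m"
  have "(e\<^sup>2)\<^sup>2 = 1" using \<open>k ^ 4 = m ^ 4\<close> \<open>m \<noteq> 0\<close> by (simp add: e_def power_divide)
  then have e: "e\<^sup>2 = 1" by (metis power2_eq_1_iff power2_less_0 zero_less_one neg_less_0_iff_less)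
  define E where "E = matrix_inv C ** D"
  have "det (matrix_inv C) = 1" using arg_cong[OF I(1), of det] C(1) by (simp add: det_mul)
  then have E: "det E = 1" using D(1) by (simp add: E_def det_mul)
  have kC: "matrix_inv C ** (k *\<^sub>R A) = M ** matrix_inv C"
    using I C by (simp add: matrix_mul_assoc)
  have mD: "(m *\<^sub>R A) ** D = D ** N" using I D by (simp flip: matrix_mul_assoc)
  have "M ** E = matrix_inv C ** (k *\<^sub>R A) ** D" by (simp add: E_def kC matrix_mul_assoc)
  also have "k *\<^sub>R A = e *\<^sub>R (m *\<^sub>R A)" using \<open>m \<noteq> 0\<close> by (simp add: e_def)
  also have "matrix_inv C ** (e *\<^sub>R (m *\<^sub>R A)) ** D = e *\<^sub>R (matrix_inv C ** ((m *\<^sub>R A) ** D))"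
    by (simp add: matrix_scalar_ac matrix_mul_assoc mult.commute flip: scalar_matrix_assoc)
  also have "\<dots> = e *\<^sub>R (E ** N)" by (simp only: mD E_def matrix_mul_assoc)
  finally show ?thesis using e E unfolding sign_similar_def by blast
qed

lemma trace_normal_forms:
  "trace (rotation_matrix \<theta>) = 4 * cos \<theta>" "trace (anti_rotation_matrix \<theta>) = 4 * cos \<theta>"
  "trace (shear_matrix a b) = 4" "trace (diagonal_matrix a b c d) = a + b + c + d"
  by (simp_all add: trace_def sum_4 normal_form_defs)

lemma trace_square_normal_forms:
  "trace (rotation_matrix \<theta> ** rotation_matrix \<theta>) = 4 * (cos \<theta>)\<^sup>2 - 4 * (sin \<theta>)\<^sup>2"
  "trace (anti_rotation_matrix \<theta> ** anti_rotation_matrix \<theta>) = 4 * (cos \<theta>)\<^sup>2 - 4 * (sin \<theta>)\<^sup>2"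
  "trace (shear_matrix a b ** shear_matrix a b) = 4"
  "trace (diagonal_matrix a b c d ** diagonal_matrix a b c d) = a\<^sup>2 + b\<^sup>2 + c\<^sup>2 + d\<^sup>2"
  by (simp_all add: trace_def sum_4 normal_form_defs matrix_matrix_mult_def power2_eq_square)

text \<open>Each normal form satisfies \<open>N\<^sup>2 = (trace N / 2) N - d\<close>, and taking
  traces turns the first expression into \<open>8 * d\<close>, where \<open>d = -1\<close> exactly
  for type 6. The squared trace compared with \<open>16\<close> then separates rotations, shears and
  the remaining diagonal forms, except for the identity.\<close>

lemma trace_invariants:
  assumes "N \<in> matrices_of_type t"
  shows "t \<noteq> Type6 \<Longrightarrow> (trace N)\<^sup>2 - 2 * trace (N ** N) = 8"
    and "t = Type6 \<Longrightarrow> (trace N)\<^sup>2 - 2 * trace (N ** N) = - 8"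
    and "t = Type1 \<or> t = Type2 \<Longrightarrow> (trace N)\<^sup>2 < 16"
    and "t = Type3 \<or> t = Type4 \<Longrightarrow> (trace N)\<^sup>2 = 16"
    and "t = Type5 \<Longrightarrow> (trace N)\<^sup>2 \<ge> 16"
    and "t = Type5 \<Longrightarrow> (trace N)\<^sup>2 = 16 \<Longrightarrow> N = mat 1"
proof -
  have trig: "(4 * cos \<theta>)\<^sup>2 - 2 * (4 * (cos \<theta>)\<^sup>2 - 4 * (sin \<theta>)\<^sup>2) = 8" for \<theta> :: real
    by (simp add: power_mult_distrib cos_squared_eq)
  show "t \<noteq> Type6 \<Longrightarrow> (trace N)\<^sup>2 - 2 * trace (N ** N) = 8"
    using assms trig
    by (cases t) (auto simp: trace_normal_forms trace_square_normal_forms field_simps power2_eq_square)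
  show "t = Type6 \<Longrightarrow> (trace N)\<^sup>2 - 2 * trace (N ** N) = - 8"
    using assms
    by (auto simp: trace_normal_forms trace_square_normal_forms field_simps power2_eq_square)
  have "(4 * cos \<theta>)\<^sup>2 < 16" if "sin \<theta> \<noteq> 0" for \<theta> :: real
    using that by (simp add: power_mult_distrib cos_squared_eq)
  then show "t = Type1 \<or> t = Type2 \<Longrightarrow> (trace N)\<^sup>2 < 16"
    using assms by (auto simp: trace_normal_forms)
  show "t = Type3 \<or> t = Type4 \<Longrightarrow> (trace N)\<^sup>2 = 16"
    using assms by (auto simp: trace_normal_forms)
  have diag: "(inverse l + inverse l + l + l)\<^sup>2 = 16 + 4 * (l - inverse l)\<^sup>2" if "l > 0" for l :: real
    using that by (simp add: field_simps power2_eq_square)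
  show "(trace N)\<^sup>2 \<ge> 16" if "t = Type5"
  proof -
    obtain l where "l > 0" "N = diagonal_matrix (inverse l) (inverse l) l l"
      using assms \<open>t = Type5\<close> by auto
    then show ?thesis using diag[of l] by (simp only: trace_normal_forms) simp
  qed
  show "N = mat 1" if "t = Type5" "(trace N)\<^sup>2 = 16"
  proof -
    obtain l where l: "l > 0" "N = diagonal_matrix (inverse l) (inverse l) l l"
      using assms \<open>t = Type5\<close> by auto
    then have "l = inverse l" using that diag[of l] by (simp add: trace_normal_forms)
    then have "l * l = 1" using l by (simp add: field_simps)
    then have "l = 1" using l square_eq_1_iff[of l] by auto
    then show ?thesis using l by (simp add: vec_eq_iff forall_4 mat_def diagonal_matrix_def)
  qed
qed

text \<open>The complex structures behind the two matrices induce opposite orientations. Replacing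
  one by its negative keeps its orientation, as the complex dimension is even, so every invertible
  intertwining matrix reverses orientation.\<close>

lemma not_sign_similar_rotation_anti_rotation:
  assumes s: "sin \<theta> \<noteq> 0" "sin \<phi> \<noteq> 0"
  shows "\<not> sign_similar (anti_rotation_matrix \<phi>) (rotation_matrix \<theta>)"
proof
  assume "sign_similar (anti_rotation_matrix \<phi>) (rotation_matrix \<theta>)"
  then obtain e C where e: "e\<^sup>2 = 1" and C: "det C = 1"
    and MC: "anti_rotation_matrix \<phi> ** C = e *\<^sub>R (C ** rotation_matrix \<theta>)"
    by (auto simp: sign_similar_def)
  \<comment> \<open>With the traces compared, the cosine terms cancel in the entries, and rows 2 and
    4 of \<open>C\<close> become determined by rows 1 and 3.\<close>
  have c: "cos \<phi> = e * cos \<theta>" using trace_intertwined[OF _ MC] C by (simp add: trace_normal_forms)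
  define r where "r = e * sin \<theta> / sin \<phi>"
  have es: "e * sin \<theta> = r * sin \<phi>" using s by (simp add: r_def)
  note entries = MC[unfolded vec_eq_iff forall_4 matrix_matrix_mult_def sum_4]
  have "C$2$1 = r * C$1$2" "C$2$2 = - r * C$1$1" "C$2$3 = r * C$1$4" "C$2$4 = - r * C$1$3"
    "C$4$1 = - r * C$3$2" "C$4$2 = r * C$3$1" "C$4$3 = - r * C$3$4" "C$4$4 = r * C$3$3"
    using entries s by (simp_all add: normal_form_defs c distrib_left r_def field_simps)
  \<comment> \<open>Up to sign, the bracket is the squared modulus of the complex \<open>2 \<times> 2\<close> determinant formed by rows 1 and 3.\<close>
  then have "det C = - r\<^sup>2 * ((C$1$1 * C$3$3 - C$1$2 * C$3$4 - C$1$3 * C$3$1 + C$1$4 * C$3$2)\<^sup>2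
      + (C$1$1 * C$3$4 + C$1$2 * C$3$3 - C$1$3 * C$3$2 - C$1$4 * C$3$1)\<^sup>2)"
    unfolding det_4 by (simp add: algebra_simps power2_eq_square)
  also have "\<dots> \<le> 0" by (simp add: mult_nonneg_nonneg)
  finally show False using C by simp
qed

text \<open>An intertwining matrix preserves the common fixed space, spanned by the first and fourth
  basis vectors. Its block there determines the block on the quotient, and the two block
  determinants differ by the factor \<open>- r\<^sup>2\<close>.\<close>

lemma not_sign_similar_shears:
  assumes l: "l \<noteq> 0" "m \<noteq> 0"
  shows "\<not> sign_similar (shear_matrix m m) (shear_matrix (- l) l)"
proof
  assume "sign_similar (shear_matrix m m) (shear_matrix (- l) l)"
  then obtain e C where e: "e\<^sup>2 = 1" and C: "det C = 1"
    and MC: "shear_matrix m m ** C = e *\<^sub>R (C ** shear_matrix (- l) l)"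
    by (auto simp: sign_similar_def)
  have "e = 1" using trace_intertwined[OF _ MC] C by (simp add: trace_normal_forms)
  note entries = MC[unfolded \<open>e = 1\<close> vec_eq_iff forall_4 matrix_matrix_mult_def sum_4]
  define r where "r = l / m"
  have "C$2$1 = 0" "C$2$4 = 0" "C$3$1 = 0" "C$3$4 = 0"
    "C$2$2 = - r * C$1$1" "C$2$3 = r * C$1$4" "C$3$2 = - r * C$4$1" "C$3$3 = r * C$4$4"
    using entries l by (simp_all add: normal_form_defs r_def field_simps)
  then have "det C = - r\<^sup>2 * (C$1$1 * C$4$4 - C$1$4 * C$4$1)\<^sup>2"
    unfolding det_4 by (simp add: algebra_simps power2_eq_square)
  also have "\<dots> \<le> 0" by (simp add: mult_nonneg_nonneg)
  finally show False using C by simp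
qed

text \<open>This separates the identity, which belongs to type 5, from the shears, whose traces
  agree with its own.\<close>

lemma sign_similar_mat_1:
  assumes "sign_similar (mat 1) N"
  obtains e where "N = e *\<^sub>R mat 1"
proof -
  obtain e C where e: "e\<^sup>2 = 1" and C: "det C = 1" and MC: "C = e *\<^sub>R (C ** N)"
    using assms by (auto simp: sign_similar_def)
  have I: "matrix_inv C ** C = mat 1" using C matrix_inv_inverse(2)[of C] by simp
  have "mat 1 = matrix_inv C ** (e *\<^sub>R (C ** N))" using I MC by simp
  also have "\<dots> = e *\<^sub>R N" using I by (simp add: matrix_scalar_ac matrix_mul_assoc flip: scalar_matrix_assoc)
  finally have "e *\<^sub>R mat 1 = e\<^sup>2 *\<^sub>R N" by (simp add: power2_eq_square)
  then have "N = e *\<^sub>R mat 1" using e by simp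
  then show thesis by (rule that)
qed

text \<open>Both directions are assumed because the obstructions beyond the traces are stated for
  one order of the two matrices.\<close>

lemma sign_similar_type_unique:
  assumes M: "M \<in> matrices_of_type s" and N: "N \<in> matrices_of_type t"
    and MN: "sign_similar M N" and NM: "sign_similar N M"
  shows "s = t"
proof -
  have 12: "\<not> (N' \<in> matrices_of_type Type1 \<and> M' \<in> matrices_of_type Type2 \<and> sign_similar M' N')" for M' N'
    using not_sign_similar_rotation_anti_rotation by auto
  have 34: "\<not> (N' \<in> matrices_of_type Type3 \<and> M' \<in> matrices_of_type Type4 \<and> sign_similar M' N')" for M' N'
    using not_sign_similar_shears by auto
  have not_scalar: "N' \<noteq> e *\<^sub>R mat 1"
    if "N' \<in> matrices_of_type u" "u = Type3 \<or> u = Type4" for N' u e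
    using that by (auto simp: vec_eq_iff forall_4 mat_def shear_matrix_def)
  have 345: "\<not> (N' \<in> matrices_of_type u \<and> (u = Type3 \<or> u = Type4) \<and> M' \<in> matrices_of_type Type5
      \<and> sign_similar M' N')" for M' N' u
  proof
    assume *: "N' \<in> matrices_of_type u \<and> (u = Type3 \<or> u = Type4) \<and> M' \<in> matrices_of_type Type5
      \<and> sign_similar M' N'"
    then have "M' = mat 1"
      using trace_invariants(4)[of N' u] trace_invariants(6)[of M' Type5] sign_similar_trace[of M' N'] by simp
    then obtain e where "N' = e *\<^sub>R mat 1" using * sign_similar_mat_1 by blast
    then show False using * not_scalar by blast
  qed
  note inv = sign_similar_trace[OF MN] trace_invariants[OF M] trace_invariants[OF N]
  show ?thesis
  proof (rule ccontr)
    assume "s \<noteq> t"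
    \<comment> \<open>The traces refute every pair of types except 1 with 2, 3 with 4, and 5 with 3
      or 4; these are refuted by \<open>12\<close>, \<open>34\<close> and
      \<open>345\<close>.\<close>
    then show False
      using inv 12[of M N] 12[of N M] 34[of M N] 34[of N M] 345[of M s N] 345[of N t M] M N MN NM
      by (cases s; cases t) (simp_all del: matrices_of_type.simps)
  qed
qed

section \<open>Existence and uniqueness of the type\<close>

text \<open>The type is read off the roots of \<open>X^2 - t X + d\<close>. For \<open>d = 1\<close>
  the trace condition excludes \<open>t \<le> -2\<close>, where the double root or both real roots
  would be negative.\<close>

lemma conjugate_normal_form_of_nonneg_trace:
  fixes P Q A :: "real^4^4"
  assumes P: "P \<in> SL4" "skew_symmetric P" and Q: "Q \<in> SL4" "skew_symmetric Q"
    and A: "A = P ** Q" and tr: "trace A \<ge> 0"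
  shows "\<exists>t. \<exists>N\<in>matrices_of_type t. conjugate_SL4 A N"
proof -
  define t d where t: "t = trace A / 2" and d: "d = pfaffian4 P * pfaffian4 Q"
  have quad: "A ** A = t *\<^sub>R A - d *\<^sub>R mat 1"
    using skew_product_quadratic[OF P(2) Q(2)] by (simp add: A t d)
  have tr2: "trace A = 2 * t" by (simp add: t)
  have detQ: "det Q \<noteq> 0" and detA: "det A = 1"
    using P Q by (simp_all add: SL4_def A det_mul)
  have "d\<^sup>2 = 1"
    using P Q by (simp add: d power_mult_distrib SL4_def flip: det_skew_symmetric)
  then have "d = 1 \<or> d = - 1" by (simp add: power2_eq_1_iff)
  moreover have "t < 2 \<or> t = 2 \<or> t > 2" by linarith
  ultimately consider (neg) "d = - 1" | (elliptic) "d = 1" "t < 2" | (parabolic) "d = 1" "t = 2"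
    | (hyperbolic) "d = 1" "t > 2"
    by blast
  then show ?thesis
  proof cases
    case neg
    \<comment> \<open>The discriminant is positive for every \<open>t\<close>; \<open>- l\<close> is
      the negative root and \<open>inverse l\<close> the positive one.\<close>
    define r where "r = sqrt (t\<^sup>2 + 4)"
    define l where "l = (r - t) / 2"
    have "t < r" unfolding r_def by (rule real_less_rsqrt) simp
    then have l: "l > 0" by (simp add: l_def)
    have "r\<^sup>2 = t\<^sup>2 + 4" by (simp add: r_def)
    have "l * (l + t) = (r\<^sup>2 - t\<^sup>2) / 4" by (simp add: l_def field_simps power2_eq_square)
    also have "\<dots> = 1" by (simp add: \<open>r\<^sup>2 = t\<^sup>2 + 4\<close>)
    finally have "l * (l + t) = 1" .
    then have "inverse l = l + t" by (rule inverse_unique)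
    then have sum: "inverse l + - l = t" by simp
    have prod: "inverse l * - l = d" using l neg by simp
    have "inverse l \<noteq> - l" using l positive_imp_inverse_positive[of l] by linarith
    then have "conjugate_SL4 A (diagonal_matrix (inverse l) (inverse l) (- l) (- l))"
      by (intro normal_form_real_distinct[OF P(2) Q(2) detQ A detA])
         (simp_all only: sum prod quad tr2 not_False_eq_True)
    then show ?thesis using l by (intro exI[of _ Type6]) auto
  next
    case elliptic
    then obtain \<theta> where "sin \<theta> \<noteq> 0"
      "conjugate_SL4 A (rotation_matrix \<theta>) \<or> conjugate_SL4 A (anti_rotation_matrix \<theta>)"
      using normal_form_elliptic[OF detA, of t] quad tr t by auto
    then show ?thesis
      using matrices_of_type.simps(1,2) by (metis (mono_tags, lifting) mem_Collect_eq)
  next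
    case parabolic
    show ?thesis
    proof (cases "A = mat 1")
      case True
      \<comment> \<open>The identity is the member \<open>l = 1\<close> of type 5.\<close>
      have "diagonal_matrix (inverse 1) (inverse 1) 1 1 = mat 1"
        by (simp add: vec_eq_iff forall_4 mat_def diagonal_matrix_def)
      moreover have "conjugate_SL4 A (mat 1)"
        using conjugate_SL4_of_det_pos[of A "mat 1" "mat 1"] detA True by simp
      ultimately show ?thesis
        by (intro exI[of _ Type5] bexI[of _ "mat 1"]) (auto intro!: exI[of _ 1])
    next
      case False
      then have "conjugate_SL4 A (shear_matrix (- 1) 1) \<or> conjugate_SL4 A (shear_matrix 1 1)"
        using normal_form_unipotent[OF P(2) Q(2) detQ A detA] quad parabolic by simp
      then show ?thesis
      proof
        assume "conjugate_SL4 A (shear_matrix (- 1) 1)"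
        then show ?thesis
          by (intro exI[of _ Type3] bexI[of _ "shear_matrix (- 1) 1"]) (auto intro!: exI[of _ 1])
      next
        assume "conjugate_SL4 A (shear_matrix 1 1)"
        then show ?thesis
          by (intro exI[of _ Type4] bexI[of _ "shear_matrix 1 1"]) (auto intro!: exI[of _ 1])
      qed
    qed
  next
    case hyperbolic
    \<comment> \<open>Here \<open>l\<close> is the larger root; the other one is
      \<open>inverse l\<close>, as the product of the roots is one.\<close>
    define r where "r = sqrt (t\<^sup>2 - 4)"
    define l where "l = (t + r) / 2"
    have "t\<^sup>2 > 4" using power_strict_mono[of 2 t 2] hyperbolic by simp
    then have "r > 0" "r\<^sup>2 = t\<^sup>2 - 4" by (simp_all add: r_def)
    then have l: "l > 1" using hyperbolic by (simp add: l_def)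
    have "l * (t - l) = (t\<^sup>2 - r\<^sup>2) / 4" by (simp add: l_def field_simps power2_eq_square)
    also have "\<dots> = 1" by (simp add: \<open>r\<^sup>2 = t\<^sup>2 - 4\<close>)
    finally have "l * (t - l) = 1" .
    then have "inverse l = t - l" by (rule inverse_unique)
    then have sum: "inverse l + l = t" by simp
    have prod: "inverse l * l = d" using l hyperbolic by simp
    have "inverse l < 1" using l by (simp add: inverse_less_1_iff)
    then have "inverse l \<noteq> l" using l by linarith
    then have "conjugate_SL4 A (diagonal_matrix (inverse l) (inverse l) l l)"
      by (intro normal_form_real_distinct[OF P(2) Q(2) detQ A detA])
         (simp_all only: sum prod quad tr2 not_False_eq_True)
    moreover have "diagonal_matrix (inverse l) (inverse l) l l \<in> matrices_of_type Type5"
      using l by force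
    ultimately show ?thesis by blast
  qed
qed

theorem proposition23:
  fixes A P Q :: "real ^ 4 ^ 4"
  assumes "P \<in> SL4" and "Q \<in> SL4"
    and "skew_symmetric P" and "skew_symmetric Q"
    and "A = P ** Q"
  shows "\<exists>!t. \<exists>k::real. k \<noteq> 0 \<and> (\<exists>N\<in>matrices_of_type t. conjugate_SL4 (k *\<^sub>R A) N)"
proof (rule ex_ex1I)
  \<comment> \<open>The sign that makes the trace nonnegative is absorbed into \<open>P\<close>: the
    dimension is even, so \<open>k *\<^sub>R P\<close> still has determinant one.\<close>
  define k :: real where "k = (if trace A \<ge> 0 then 1 else - 1)"
  have "k \<noteq> 0" by (simp add: k_def)
  have "k *\<^sub>R P \<in> SL4" using assms(1) by (simp add: k_def SL4_def det_scaleR)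
  moreover have "skew_symmetric (k *\<^sub>R P)"
    using assms(3) by (simp add: skew_symmetric_def k_def transpose_scalar)
  moreover have "k *\<^sub>R A = (k *\<^sub>R P) ** Q" by (simp add: assms(5) scalar_matrix_assoc)
  moreover have "trace (k *\<^sub>R A) \<ge> 0" by (simp add: trace_scaleR k_def)
  ultimately have "\<exists>t. \<exists>N\<in>matrices_of_type t. conjugate_SL4 (k *\<^sub>R A) N"
    using conjugate_normal_form_of_nonneg_trace assms(2,4) by blast
  then show "\<exists>t. \<exists>k::real. k \<noteq> 0 \<and> (\<exists>N\<in>matrices_of_type t. conjugate_SL4 (k *\<^sub>R A) N)"
    using \<open>k \<noteq> 0\<close> by blast
next
  fix s t
  assume "\<exists>k::real. k \<noteq> 0 \<and> (\<exists>N\<in>matrices_of_type s. conjugate_SL4 (k *\<^sub>R A) N)"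
    and "\<exists>k::real. k \<noteq> 0 \<and> (\<exists>N\<in>matrices_of_type t. conjugate_SL4 (k *\<^sub>R A) N)"
  then show "s = t"
    using sign_similar_type_unique conjugate_SL4_sign_similar by metis
qed

end
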